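(* Let $2\leq X\leq T$ and $U\geq X$. Then \[ \sum_{0<\gamma_X\leq T}(\beta_X+U)=U\frac{T}{2\pi}\log X+O(UX)+O(T), \] where the sum runs over the zeros $\rho_X=\beta_X+i\gamma_X$ of $F_X(s)=\sum_{n\leq X}n^{-s}$ with $0<\gamma_X\leq T$, counted with multiplicity, and the implied constants are absolute.
   Context: $s=\sigma+it$, $X$ real, $F_X(s)=\sum_{n\leq X}n^{-s}$ is the partial sum of the Riemann zeta-function; zeros are written $\rho_X=\beta_X+i\gamma_X$.
   Formalization: The main term is proved with log⌊X⌋ in place of log X (the same for integer X); for real X the printed form fails, since F_2 = F_{5/2} while with U = T the two main terms differ by T² log(5/4)/(2π), which is not O(T). *)

theory Defs
  imports "HOL-Complex_Analysis.Complex_Analysis"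
begin

definition zeta_partial_sum :: "real \<Rightarrow> complex \<Rightarrow> complex" where
  "zeta_partial_sum X s = (\<Sum>n | 1 \<le> n \<and> real n \<le> X. of_nat n powr (- s))"

definition zeta_partial_sum_zeros :: "real \<Rightarrow> real \<Rightarrow> complex set" where
  "zeta_partial_sum_zeros X T = {\<rho>. zeta_partial_sum X \<rho> = 0 \<and> 0 < Im \<rho> \<and> Im \<rho> \<le> T}"

text \<open>
  Sums over \<^const>\<open>zeta_partial_sum_zeros\<close> are genuine finite sums: \<^term>\<open>zeta_partial_sum X\<close>
  is dominated by a single term far to the left and far to the right, so its zeros lie in a
  vertical strip.
\<close>

lemma finite_zeta_index: "finite {n. 1 \<le> n \<and> real n \<le> X}"
proof (rule finite_subset)
  show "{n. 1 \<le> n \<and> real n \<le> X} \<subseteq> {..nat \<lfloor>X\<rfloor>}"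
    by (auto simp: le_nat_floor)
qed simp

lemma zeta_partial_sum_zero_dominated:
  assumes "zeta_partial_sum X s = 0" "1 \<le> m" "real m \<le> X"
  shows "1 \<le> (\<Sum>n\<in>{n. 1 \<le> n \<and> real n \<le> X} - {m}. (real n / real m) powr (- Re s))"
proof -
  let ?I = "{n. 1 \<le> n \<and> real n \<le> X}"
  have nrm: "norm (of_nat n powr (- s) :: complex) = real n powr (- Re s)" for n
    by (cases "n = 0") (simp_all add: norm_powr_real_powr)
  have "(of_nat m powr (- s) :: complex) + (\<Sum>n\<in>?I - {m}. of_nat n powr (- s)) = 0"
    using assms sum.remove[OF finite_zeta_index, of m X "\<lambda>n. of_nat n powr (- s) :: complex"]
    by (simp add: zeta_partial_sum_def)
  hence "(of_nat m powr (- s) :: complex) = - (\<Sum>n\<in>?I - {m}. of_nat n powr (- s))"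
    by (simp add: eq_neg_iff_add_eq_0)
  hence "norm (of_nat m powr (- s) :: complex) = norm (\<Sum>n\<in>?I - {m}. (of_nat n powr (- s) :: complex))"
    by simp
  also have "\<dots> \<le> (\<Sum>n\<in>?I - {m}. norm (of_nat n powr (- s) :: complex))"
    by (rule norm_sum)
  finally have "real m powr (- Re s) \<le> (\<Sum>n\<in>?I - {m}. real n powr (- Re s))"
    by (simp only: nrm)
  moreover have "real m powr (- Re s) > 0" using assms by simp
  ultimately have "1 \<le> (\<Sum>n\<in>?I - {m}. real n powr (- Re s)) / real m powr (- Re s)"
    by (simp add: field_simps)
  also have "\<dots> = (\<Sum>n\<in>?I - {m}. (real n / real m) powr (- Re s))"
    unfolding sum_divide_distrib by (intro sum.cong refl) (simp add: powr_divide)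
  finally show ?thesis .
qed

lemma tendsto_powr_at_top_0:
  assumes "0 < c" "c < (1::real)"
  shows "((\<lambda>a. c powr a) \<longlongrightarrow> 0) at_top"
proof -
  have "filterlim (\<lambda>a. ln c * a) at_bot at_top"
    using assms by (intro filterlim_tendsto_neg_mult_at_bot[OF tendsto_const] filterlim_ident) auto
  hence "((\<lambda>a. exp (ln c * a)) \<longlongrightarrow> 0) at_top"
    by (rule filterlim_compose[OF exp_at_bot])
  thus ?thesis using assms by (simp add: powr_def mult.commute)
qed

lemma zeta_partial_sum_zeros_strip:
  assumes "1 \<le> X"
  obtains A where "\<And>s. zeta_partial_sum X s = 0 \<Longrightarrow> \<bar>Re s\<bar> \<le> A"
proof -
  let ?I = "{n. 1 \<le> n \<and> real n \<le> X}"
  define N where "N = nat \<lfloor>X\<rfloor>"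
  have N: "1 \<le> N" "real N \<le> X" using assms by (auto simp: N_def le_nat_floor)
  have le_N: "n \<le> N" if "n \<in> ?I" for n using that by (auto simp: N_def le_nat_floor)
  have "((\<lambda>a. \<Sum>n\<in>?I - {N}. (real n / real N) powr a) \<longlongrightarrow> (\<Sum>n\<in>?I - {N}. 0)) at_top"
    using le_N N by (intro tendsto_sum tendsto_powr_at_top_0) (force simp: field_simps)+
  hence "\<forall>\<^sub>F a in at_top. (\<Sum>n\<in>?I - {N}. (real n / real N) powr a) < 1"
    by (auto dest: order_tendstoD(2)[of _ _ _ 1])
  then obtain a where a: "\<And>x. x \<ge> a \<Longrightarrow> (\<Sum>n\<in>?I - {N}. (real n / real N) powr x) < 1"
    by (auto simp: eventually_at_top_linorder)
  have "((\<lambda>a. \<Sum>n\<in>?I - {1}. (1 / real n) powr a) \<longlongrightarrow> (\<Sum>n\<in>?I - {1}. 0)) at_top"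
    by (intro tendsto_sum tendsto_powr_at_top_0) auto
  hence "\<forall>\<^sub>F a in at_top. (\<Sum>n\<in>?I - {1}. (1 / real n) powr a) < 1"
    by (auto dest: order_tendstoD(2)[of _ _ _ 1])
  then obtain b where b: "\<And>x. x \<ge> b \<Longrightarrow> (\<Sum>n\<in>?I - {1}. (1 / real n) powr x) < 1"
    by (auto simp: eventually_at_top_linorder)
  have "\<bar>Re s\<bar> \<le> max a b" if "zeta_partial_sum X s = 0" for s
  proof -
    have "\<not> - Re s \<ge> a"
      using zeta_partial_sum_zero_dominated[OF that N] a[of "- Re s"] by auto
    moreover have "(\<Sum>n\<in>?I - {1}. (real n / real 1) powr (- Re s)) = (\<Sum>n\<in>?I - {1}. (1 / real n) powr Re s)"
      by (intro sum.cong refl) (simp add: powr_minus powr_divide field_simps)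
    hence "\<not> Re s \<ge> b"
      using zeta_partial_sum_zero_dominated[OF that, of 1] assms b[of "Re s"] by auto
    ultimately show ?thesis by linarith
  qed
  thus ?thesis by (rule that)
qed

lemma zeta_partial_sum_holomorphic: "zeta_partial_sum X holomorphic_on S"
proof -
  have "(\<lambda>s. of_nat n powr (- s) :: complex) holomorphic_on S" if "1 \<le> n" for n
    using that by (intro holomorphic_intros) auto
  thus ?thesis
    unfolding zeta_partial_sum_def[abs_def] by (intro holomorphic_on_sum) auto
qed

lemma finite_zeta_partial_sum_zeros:
  assumes "1 \<le> X"
  shows "finite (zeta_partial_sum_zeros X T)"
proof (cases "zeta_partial_sum X constant_on UNIV")
  case True
  then obtain c where c: "\<And>s. zeta_partial_sum X s = c"
    by (auto simp: constant_on_def)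
  have "zeta_partial_sum X 0 = of_nat (card {n. 1 \<le> n \<and> real n \<le> X})"
    by (simp add: zeta_partial_sum_def)
  moreover have "{n. 1 \<le> n \<and> real n \<le> X} \<noteq> {}" using assms by (auto intro!: exI[of _ 1])
  ultimately have "c \<noteq> 0" using c[of 0] finite_zeta_index[of X] by (metis card_0_eq of_nat_eq_0_iff)
  thus ?thesis by (simp add: zeta_partial_sum_zeros_def c)
next
  case False
  obtain A where A: "\<And>s. zeta_partial_sum X s = 0 \<Longrightarrow> \<bar>Re s\<bar> \<le> A"
    using zeta_partial_sum_zeros_strip[OF assms] by blast
  let ?K = "cbox (Complex (- A) 0) (Complex A T)"
  have "finite {z \<in> ?K. zeta_partial_sum X z = 0}"
    using False by (intro holomorphic_compact_finite_zeros[of _ UNIV] zeta_partial_sum_holomorphic) auto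
  moreover have "zeta_partial_sum_zeros X T \<subseteq> {z \<in> ?K. zeta_partial_sum X z = 0}"
    using A by (fastforce simp: zeta_partial_sum_zeros_def in_cbox_complex_iff abs_le_iff)
  ultimately show ?thesis by (rule finite_subset[rotated])
qed

end

theory Submission
  imports Defs
begin

text \<open>
  Let \<open>N = \<lfloor>X\<rfloor>\<close> and \<open>w = -U + iT\<close>. By the argument principle, the sum of \<open>\<rho> - w\<close> over the zeros
  is the integral of \<open>(s - w) F'(s) / F(s)\<close> over the boundary of \<open>[-U, 3] \<times> [0, T]\<close>, divided by
  \<open>2\<pi>i\<close>; its real part is the wanted sum. Each edge is integrated by parts against a logarithm
  of \<open>F\<close>.

  On the bottom edge \<open>F\<close> is real and positive, and the imaginary part of the integral is
  \<open>T (ln F(-U) - ln F(3)) = T U ln N + O(T)\<close>. On the right edge the first term of \<open>F\<close> dominates,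
  and on the left edge the last one does, because \<open>U \<ge> N\<close>. So, up to the factor \<open>N\<^sup>-\<^sup>s\<close> on the left,
  which contributes nothing to the imaginary part, the logarithm is bounded there.

  Since \<open>s - w\<close> is real on the top edge, only the variation of \<open>arg F\<close> matters there. Between two
  zeros of \<open>Re F\<close> the argument changes by at most \<open>\<pi>\<close>, and
  \<open>Re F(\<sigma> + iT) = \<Sum> cos (T ln n) exp (- \<sigma> ln n)\<close> is a nontrivial real exponential sum with \<open>N\<close>
  terms, so by Rolle's theorem it has fewer than \<open>N\<close> zeros. The top edge contributes \<open>O(U N)\<close>.
\<close>

section \<open>Zeros of real exponential sums and the variation of an argument\<close>

lemma Rolle_finite_zeros:
  fixes f f' :: "real \<Rightarrow> real"
  assumes "finite Z" and "\<And>x. x \<in> Z \<Longrightarrow> f x = 0"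
    and der: "\<And>x. (f has_real_derivative f' x) (at x)"
  shows "\<exists>Z'. finite Z' \<and> card Z \<le> card Z' + 1 \<and> (\<forall>x\<in>Z'. f' x = 0 \<and> (\<exists>y\<in>Z. x < y))"
  using assms(1,2)
proof (induction Z rule: finite_linorder_max_induct)
  case empty
  show ?case by (intro exI[of _ "{}"]) auto
next
  case (insert b A)
  show ?case
  proof (cases "A = {}")
    case True
    then show ?thesis by (intro exI[of _ "{}"]) auto
  next
    case False
    obtain Z' where Z': "finite Z'" "card A \<le> card Z' + 1"
      "\<forall>x\<in>Z'. f' x = 0 \<and> (\<exists>y\<in>A. x < y)"
      using insert by blast
    define m where "m = Max A"
    have m: "m \<in> A" "\<And>x. x \<in> A \<Longrightarrow> x \<le> m"
      using False insert.hyps by (auto simp: m_def)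
    have "m < b" using m insert.hyps by blast
    have "continuous_on {m..b} f"
      using der by (auto intro!: continuous_at_imp_continuous_on DERIV_isCont)
    moreover have "(f has_derivative (*) (f' x)) (at x)" for x
      using der[of x] by (simp add: has_field_derivative_def)
    ultimately obtain z where z: "m < z" "z < b" "(*) (f' z) = (\<lambda>v. 0)"
      using Rolle_deriv[of m b f "\<lambda>x. (*) (f' x)"] \<open>m < b\<close> insert.prems m(1) by auto
    have "f' z = 0" using fun_cong[OF z(3), of 1] by simp
    \<comment> \<open>Every point of \<open>Z'\<close> lies below some point of \<open>A\<close>,
      hence below \<open>m\<close>, while \<open>z\<close> lies above \<open>m\<close>. The clause
      \<open>x < y\<close> is carried through the induction to make \<open>z\<close> a new
      zero.\<close>
    have "z \<notin> Z'" using Z'(3) m(2) z(1) by force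
    show ?thesis
    proof (intro exI[of _ "insert z Z'"] conjI ballI)
      show "card (insert b A) \<le> card (insert z Z') + 1"
        using Z' \<open>z \<notin> Z'\<close> insert.hyps by (subst card_insert_disjoint) auto
    qed (use Z' \<open>f' z = 0\<close> z in auto)
  qed
qed

text \<open>Dividing by \<open>exp (l i * x)\<close> keeps the zeros and turns one term into a
  constant, which differentiation removes; by Rolle this costs at most one zero. Distinct
  frequencies keep the remaining nonzero coefficients nonzero. If only the term \<open>i\<close> has
  a nonzero coefficient, there is no zero at all.\<close>

lemma card_zeros_exponential_sum:
  fixes l c :: "'a \<Rightarrow> real"
  assumes "finite I" "inj_on l I" "\<exists>i\<in>I. c i \<noteq> 0"
    and "finite Z" "\<And>x. x \<in> Z \<Longrightarrow> (\<Sum>i\<in>I. c i * exp (l i * x)) = 0"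
  shows "card Z < card I"
  using assms
proof (induction I arbitrary: l c Z rule: finite_induct)
  case empty
  then show ?case by simp
next
  case (insert i J)
  show ?case
  proof (cases "\<exists>j\<in>J. c j \<noteq> 0")
    case False
    then have "c i \<noteq> 0" using insert.prems(2) by auto
    moreover have "(\<Sum>j\<in>insert i J. c j * exp (l j * x)) = c i * exp (l i * x)" for x
      using False insert.hyps by (simp add: sum.neutral)
    ultimately have "Z = {}" using insert.prems(4) by auto
    then show ?thesis using insert.hyps by simp
  next
    case True
    define f where "f x = c i + (\<Sum>j\<in>J. c j * exp ((l j - l i) * x))" for x
    define f' where "f' x = (\<Sum>j\<in>J. (c j * (l j - l i)) * exp ((l j - l i) * x))" for x
    have "f x = 0" if "x \<in> Z" for x
    proof -
      have "f x = exp (- (l i * x)) * (\<Sum>j\<in>insert i J. c j * exp (l j * x))"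
        using insert.hyps
        by (simp add: f_def sum_distrib_left distrib_left exp_diff exp_minus left_diff_distrib field_simps)
      then show ?thesis using insert.prems(4)[OF that] by simp
    qed
    moreover have "(f has_real_derivative f' x) (at x)" for x
      unfolding f_def[abs_def] f'_def by (auto intro!: derivative_eq_intros sum.cong)
    ultimately obtain Z' where Z': "finite Z'" "card Z \<le> card Z' + 1" "\<forall>x\<in>Z'. f' x = 0"
      using Rolle_finite_zeros[OF insert.prems(3), of f f'] by blast
    have "card Z' < card J"
    proof (rule insert.IH[where l = "\<lambda>j. l j - l i" and c = "\<lambda>j. c j * (l j - l i)"])
      show "inj_on (\<lambda>j. l j - l i) J"
        using insert.prems(1) by (auto simp: inj_on_def)
      show "\<exists>j\<in>J. c j * (l j - l i) \<noteq> 0"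
        using True insert.prems(1) insert.hyps by (auto simp: inj_on_def)
      show "(\<Sum>j\<in>J. c j * (l j - l i) * exp ((l j - l i) * x)) = 0" if "x \<in> Z'" for x
        using Z'(3) that by (simp add: f'_def)
    qed (fact Z'(1))
    then show ?thesis using Z'(2) insert.hyps by simp
  qed
qed

text \<open>The zeros of cos are spaced by pi, so a rise of more than \<open>pi * (k + 1)\<close>
  would pass through \<open>k + 1\<close> of them, and the intermediate value theorem would give
  \<open>k + 1\<close> distinct points.\<close>

lemma increment_le_of_cos_zeros:
  fixes \<theta> :: "real \<Rightarrow> real"
  assumes "a \<le> b" "continuous_on {a..b} \<theta>"
    and Z: "\<And>Z. finite Z \<Longrightarrow> Z \<subseteq> {a..b} \<Longrightarrow> (\<And>x. x \<in> Z \<Longrightarrow> cos (\<theta> x) = 0) \<Longrightarrow> card Z \<le> k"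
  shows "\<theta> b - \<theta> a \<le> pi * (real k + 1)"
proof (rule ccontr)
  assume "\<not> ?thesis"
  then have big: "\<theta> b > \<theta> a + pi * (real k + 1)" by simp
  \<comment> \<open>\<open>v 0\<close> is the first zero of cos at or above the initial value. The
    ceiling overshoots by at most 1, so \<open>v k\<close> exceeds that value by at most
    \<open>pi * (k + 1)\<close>.\<close>
  define m where "m = \<lceil>\<theta> a / pi - 1 / 2\<rceil>"
  have m: "\<theta> a / pi - 1 / 2 \<le> of_int m" "of_int m \<le> \<theta> a / pi - 1 / 2 + 1"
    unfolding m_def by (rule le_of_int_ceiling, rule of_int_ceiling_le_add_one)
  define v where "v j = pi * (of_int m + real j) + pi / 2" for j :: nat
  have "\<exists>x. a \<le> x \<and> x \<le> b \<and> \<theta> x = v j" if "j \<le> k" for j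
  proof (rule IVT')
    have "\<theta> a = pi * (\<theta> a / pi - 1 / 2) + pi / 2" by (simp add: field_simps)
    also have "\<dots> \<le> v j"
      unfolding v_def using m(1) pi_ge_zero by (intro add_mono mult_left_mono) linarith+
    finally show "\<theta> a \<le> v j" .
    have "v j \<le> pi * ((\<theta> a / pi - 1 / 2 + 1) + real k) + pi / 2"
      unfolding v_def using m(2) that pi_ge_zero by (intro add_mono mult_left_mono) linarith+
    also have "\<dots> = \<theta> a + pi * (real k + 1)" by (simp add: field_simps)
    finally show "v j \<le> \<theta> b" using big by linarith
  qed (use assms in auto)
  then obtain x where x: "\<And>j. j \<le> k \<Longrightarrow> a \<le> x j \<and> x j \<le> b \<and> \<theta> (x j) = v j"
    by metis
  have inj: "inj_on x {..k}"
  proof (rule inj_onI)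
    fix i j assume "i \<in> {..k}" "j \<in> {..k}" "x i = x j"
    then have "v i = v j" using x[of i] x[of j] by simp
    then show "i = j" by (simp add: v_def)
  qed
  have "cos (v j) = 0" for j
  proof -
    have "v j = of_int (2 * (m + int j) + 1) * (pi / 2)" by (simp add: v_def algebra_simps)
    then show ?thesis unfolding cos_zero_iff_int
      by (intro exI[of _ "2 * (m + int j) + 1"]) auto
  qed
  then have "card (x ` {..k}) \<le> k"
    using x by (intro Z) auto
  then show False using card_image[OF inj] by simp
qed

lemma variation_le_of_cos_zeros:
  fixes \<theta> :: "real \<Rightarrow> real"
  assumes "a \<le> b" "continuous_on {a..b} \<theta>"
    and "\<And>Z. finite Z \<Longrightarrow> Z \<subseteq> {a..b} \<Longrightarrow> (\<And>x. x \<in> Z \<Longrightarrow> cos (\<theta> x) = 0) \<Longrightarrow> card Z \<le> k"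
  shows "\<bar>\<theta> b - \<theta> a\<bar> \<le> pi * (real k + 1)"
proof -
  have "\<theta> b - \<theta> a \<le> pi * (real k + 1)"
    by (rule increment_le_of_cos_zeros[OF assms])
  moreover have "- \<theta> b - (- \<theta> a) \<le> pi * (real k + 1)"
  proof (rule increment_le_of_cos_zeros[where \<theta> = "\<lambda>x. - \<theta> x"])
    show "card Z \<le> k" if "finite Z" "Z \<subseteq> {a..b}" "\<And>x. x \<in> Z \<Longrightarrow> cos (- \<theta> x) = 0" for Z
      using that by (intro assms(3)) simp_all
  qed (use assms(1,2) in \<open>simp_all add: continuous_on_minus\<close>)
  ultimately show ?thesis by linarith
qed

section \<open>Logarithms along segments and integration by parts\<close>

lemma log_derivative_primitive_along_linepath:
  fixes f :: "complex \<Rightarrow> complex"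
  assumes "f holomorphic_on UNIV" and nz: "\<And>z. z \<in> closed_segment a b \<Longrightarrow> f z \<noteq> 0"
  obtains A where
    "\<And>t. t \<in> {0..1} \<Longrightarrow> (A has_vector_derivative
        deriv f (linepath a b t) / f (linepath a b t) * (b - a)) (at t within {0..1})"
    "\<And>t. t \<in> {0..1} \<Longrightarrow> exp (A t) = f (linepath a b t)"
proof -
  let ?\<gamma> = "linepath a b"
  define g where "g t = deriv f (?\<gamma> t) / f (?\<gamma> t) * (b - a)" for t
  \<comment> \<open>The values of \<open>f\<close> may wind around 0 along the segment, so the
    principal logarithm of \<open>f\<close> need not be continuous. Integrating \<open>f'/f\<close>
    gives a continuous branch: \<open>f * exp (- A)\<close> has derivative 0 and starts at
    1.\<close>
  define A where "A t = Ln (f a) + integral {0..t} g" for t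
  have nz': "f (?\<gamma> t) \<noteq> 0" if "t \<in> {0..1}" for t
    using nz linepath_in_path[OF that] by blast
  have f': "(f has_field_derivative deriv f z) (at z)" for z
    using assms(1) by (simp add: holomorphic_derivI)
  have cf: "continuous_on UNIV f" "continuous_on UNIV (deriv f)"
    using assms(1) by (auto intro!: holomorphic_on_imp_continuous_on holomorphic_deriv)
  have "continuous_on {0..1} g"
    unfolding g_def[abs_def]
    by (intro continuous_intros continuous_on_compose2[OF cf(1)] continuous_on_compose2[OF cf(2)]
        continuous_on_linepath) (use nz' in auto)
  then have A': "(A has_vector_derivative g t) (at t within {0..1})" if "t \<in> {0..1}" for t
    unfolding A_def[abs_def] using that
    by (auto intro!: derivative_eq_intros integral_has_vector_derivative)
  have fl': "((\<lambda>t. f (?\<gamma> t)) has_vector_derivative deriv f (?\<gamma> t) * (b - a)) (at t within {0..1})" for t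
    using field_vector_diff_chain_within[OF has_vector_derivative_linepath_within
        has_field_derivative_at_within[OF f']]
    by (simp add: o_def mult.commute)
  have E': "((\<lambda>t. exp (- A t)) has_vector_derivative (- g t) * exp (- A t)) (at t within {0..1})"
    if "t \<in> {0..1}" for t
    using field_vector_diff_chain_within[OF has_vector_derivative_minus[OF A'[OF that]] 
        has_field_derivative_at_within[OF DERIV_exp]]
    by (simp add: o_def)
  have "((\<lambda>t. f (?\<gamma> t) * exp (- A t)) has_vector_derivative 0) (at t within {0..1})"
    if "t \<in> {0..1}" for t
    using has_vector_derivative_mult[OF fl' E'[OF that]] nz'[OF that]
    by (simp add: g_def field_simps)
  then obtain c where c: "\<And>t. t \<in> {0..1} \<Longrightarrow> f (?\<gamma> t) * exp (- A t) = c"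
    using has_vector_derivative_zero_constant[of "{0..1}" "\<lambda>t. f (?\<gamma> t) * exp (- A t)"] by auto
  have "c = 1"
    using c[of 0] nz[of a] by (simp add: A_def linepath_0' exp_minus)
  show ?thesis
  proof (rule that)
    show "exp (A t) = f (?\<gamma> t)" if "t \<in> {0..1}" for t
      using c[OF that] \<open>c = 1\<close> by (simp add: exp_minus field_simps)
  qed (use A' in \<open>simp add: g_def\<close>)
qed

lemma continuous_on_has_vector_derivative:
  "(\<And>t. t \<in> S \<Longrightarrow> (A has_vector_derivative A' t) (at t within S)) \<Longrightarrow> continuous_on S A"
  unfolding continuous_on_eq_continuous_within by (blast intro: has_vector_derivative_continuous)

text \<open>When \<open>f\<close> is a logarithmic derivative, this trades it for its primitive
  \<open>A\<close>, so that the edge estimates need only bounds for a logarithm.\<close>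

lemma has_contour_integral_linepath_by_parts:
  fixes f :: "complex \<Rightarrow> complex"
  assumes A: "\<And>t. t \<in> {0..1} \<Longrightarrow>
      (A has_vector_derivative f (linepath a b t) * (b - a)) (at t within {0..1})"
  shows "((\<lambda>s. (s - w) * f s) has_contour_integral
      (b - w) * A 1 - (a - w) * A 0 - (b - a) * integral {0..1} A) (linepath a b)"
proof -
  let ?\<gamma> = "linepath a b"
  have contA: "continuous_on {0..1} A"
    using A by (rule continuous_on_has_vector_derivative)
  have "((\<lambda>t. (?\<gamma> t - w) * A t) has_vector_derivative
      (?\<gamma> t - w) * (f (?\<gamma> t) * (b - a)) + (b - a) * A t) (at t within {0..1})"
    if "t \<in> {0..1}" for t
    by (intro has_vector_derivative_mult A that)
       (simp add: has_vector_derivative_diff_const has_vector_derivative_linepath_within)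
  then have 1: "((\<lambda>t. (?\<gamma> t - w) * (f (?\<gamma> t) * (b - a)) + (b - a) * A t) has_integral
      (?\<gamma> 1 - w) * A 1 - (?\<gamma> 0 - w) * A 0) {0..1}"
    by (intro fundamental_theorem_of_calculus) auto
  have 2: "((\<lambda>t. (b - a) * A t) has_integral (b - a) * integral {0..1} A) {0..1}"
    using contA by (intro has_integral_mult_right integrable_integral integrable_continuous_real)
  have "((\<lambda>t. (?\<gamma> t - w) * (f (?\<gamma> t) * (b - a))) has_integral
      (?\<gamma> 1 - w) * A 1 - (?\<gamma> 0 - w) * A 0 - (b - a) * integral {0..1} A) {0..1}"
    using has_integral_diff[OF 1 2] by simp
  then show ?thesis
    unfolding has_contour_integral_linepath
    by (simp add: linepath_0' linepath_1' mult.assoc)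
qed

lemma Ln_linepath_has_vector_derivative:
  assumes "(f has_field_derivative f') (at (linepath a b t))" "f (linepath a b t) \<notin> \<real>\<^sub>\<le>\<^sub>0"
  shows "((\<lambda>t. Ln (f (linepath a b t))) has_vector_derivative
      f' / f (linepath a b t) * (b - a)) (at t within S)"
proof -
  have "((\<lambda>z. Ln (f z)) has_field_derivative f' / f (linepath a b t)) (at (linepath a b t))"
    using assms by (auto intro!: derivative_eq_intros simp: field_simps)
  from field_vector_diff_chain_within[OF has_vector_derivative_linepath_within
        has_field_derivative_at_within[OF this]]
  show ?thesis by (simp add: o_def mult.commute)
qed

lemma near_1_not_nonpos_Reals:
  fixes z :: complex
  assumes "norm (z - 1) \<le> 2 / 3"
  shows "z \<notin> \<real>\<^sub>\<le>\<^sub>0"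
  using abs_Re_le_cmod[of "z - 1"] assms by (auto simp: complex_nonpos_Reals_iff)

text \<open>The bound is 6 = 2 + 4: \<open>ln x <= x - 1\<close> at the norm and at its inverse,
  which is at most 3, bounds the real part by 2, and the imaginary part is at most pi < 4.\<close>

lemma norm_Ln_near_1:
  fixes z :: complex
  assumes "norm (z - 1) \<le> 2 / 3"
  shows "norm (Ln z) \<le> 6"
proof -
  have nz: "z \<noteq> 0" using assms by auto
  have z: "1 / 3 \<le> norm z" "norm z \<le> 5 / 3"
    using assms norm_triangle_ineq3[of z 1] by auto
  have "ln (norm z) \<le> 2" using z ln_le_minus_one[of "norm z"] by linarith
  moreover have "- ln (norm z) \<le> 2"
  proof -
    have "inverse (norm z) \<le> inverse (1 / 3)" using z by (intro le_imp_inverse_le) auto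
    then show ?thesis
      using ln_le_minus_one[of "inverse (norm z)"] nz by (simp add: ln_inverse)
  qed
  ultimately have "\<bar>Re (Ln z)\<bar> \<le> 2" using nz by simp
  moreover have "\<bar>Im (Ln z)\<bar> \<le> 4"
    using mpi_less_Im_Ln[OF nz] Im_Ln_le_pi[OF nz] pi_less_4 by linarith
  ultimately show ?thesis using cmod_le[of "Ln z"] by linarith
qed

section \<open>Partial sums as exponential sums, dominated by one term far to the right and
  left\<close>

definition zsum :: "nat \<Rightarrow> complex \<Rightarrow> complex" where
  "zsum N s = (\<Sum>n=1..N. exp (- (s * of_real (ln (real n)))))"

text \<open>The sum depends on \<open>X\<close> only through its integer part. For n >= 1 the
  principal logarithm is the real one, so powers become exponentials whose exponents simply
  add.\<close>

lemma zeta_partial_sum_eq_zsum: "zeta_partial_sum X = zsum (nat \<lfloor>X\<rfloor>)"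
proof
  fix s
  have "{n. 1 \<le> n \<and> real n \<le> X} = {1..nat \<lfloor>X\<rfloor>}"
    by (auto simp: le_nat_floor) linarith
  then show "zeta_partial_sum X s = zsum (nat \<lfloor>X\<rfloor>) s"
    unfolding zeta_partial_sum_def zsum_def
    by (intro sum.cong) (auto simp: powr_def Ln_of_nat)
qed

lemma zsum_holomorphic: "zsum N holomorphic_on S"
  unfolding zsum_def[abs_def] by (intro holomorphic_intros)

lemma zsum_has_field_derivative: "(zsum N has_field_derivative deriv (zsum N) s) (at s)"
  using zsum_holomorphic[of N UNIV] by (simp add: holomorphic_derivI)

text \<open>Telescoping: \<open>1 / (n + 1)^3 <= 1 / (2 n) - 1 / (2 (n + 1))\<close>. The total
  stays below 1/2, which makes the abscissa 3 a safe right edge.\<close>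

lemma sum_inverse_cubes_le: "N \<ge> 1 \<Longrightarrow> (\<Sum>n=2..N. exp (- (3 * ln (real n)))) \<le> 1 / 2 - 1 / (2 * real N)"
proof (induction N rule: dec_induct)
  case base
  then show ?case by simp
next
  case (step N)
  have "exp (- (3 * ln (real (Suc N)))) = 1 / real (Suc N) ^ 3"
    using exp_of_nat_mult[of 3 "ln (real (Suc N))"] by (simp add: exp_minus inverse_eq_divide)
  also have "\<dots> \<le> 1 / (2 * real N) - 1 / (2 * real (Suc N))"
  proof -
    define x where "x = real N"
    have "x \<ge> 1" using step by (simp add: x_def)
    then have "2 * x * (x + 1) \<le> (x + 1) ^ 3"
      by (simp add: power3_eq_cube algebra_simps)
    then have "1 / (x + 1) ^ 3 \<le> 1 / (2 * x * (x + 1))"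
      using \<open>x \<ge> 1\<close> by (intro divide_left_mono) auto
    also have "\<dots> = 1 / (2 * x) - 1 / (2 * (x + 1))"
      using \<open>x \<ge> 1\<close> by (simp add: field_simps)
    finally show ?thesis by (simp add: x_def add.commute)
  qed
  finally show ?case using step by simp
qed

lemma zsum_near_1:
  assumes "N \<ge> 1" "Re s \<ge> 3"
  shows "norm (zsum N s - 1) \<le> 2 / 3"
proof -
  have "zsum N s - 1 = (\<Sum>n=2..N. exp (- (s * of_real (ln (real n)))))"
    using assms(1) by (simp add: zsum_def sum.atLeast_Suc_atMost numeral_2_eq_2)
  also have "norm \<dots> \<le> (\<Sum>n=2..N. exp (- (3 * ln (real n))))"
    using assms(2) by (intro sum_norm_le) (auto intro!: mult_right_mono)
  also have "\<dots> \<le> 2 / 3"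
  proof -
    have "0 \<le> 1 / (2 * real N)" by simp
    then show ?thesis using sum_inverse_cubes_le[OF assms(1)] by linarith
  qed
  finally show ?thesis .
qed

text \<open>Passing from \<open>N\<close> to \<open>N + 1\<close> sends the sum S to
  \<open>2/5 * S + 2/5\<close>, a map with fixed point 2/3.\<close>

lemma sum_powers_two_fifths_le: "(\<Sum>n=1..<N. (2 / 5 :: real) ^ (N - n)) \<le> 2 / 3"
proof (induction N)
  case (Suc N)
  show ?case
  proof (cases "N = 0")
    case False
    have "(\<Sum>n=1..<Suc N. (2 / 5 :: real) ^ (Suc N - n)) = (\<Sum>n=1..<N. (2 / 5) ^ (Suc N - n)) + 2 / 5"
      using False by simp
    also have "(\<Sum>n=1..<N. (2 / 5 :: real) ^ (Suc N - n)) = 2 / 5 * (\<Sum>n=1..<N. (2 / 5) ^ (N - n))"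
      unfolding sum_distrib_left by (intro sum.cong) (auto simp: Suc_diff_le)
    finally show ?thesis using Suc by simp
  qed simp
qed simp

text \<open>The factor \<open>N^s\<close> turns the last term into 1. Since
  \<open>ln x <= x - 1\<close>, the other terms are bounded by
  \<open>(n / N)^N <= exp (- (N - n))\<close>, and \<open>exp (- 1) <= 2/5\<close> gives a geometric
  series.\<close>

lemma scaled_zsum_near_1:
  assumes "N \<ge> 1" "Re s \<le> - real N"
  shows "norm (exp (s * of_real (ln (real N))) * zsum N s - 1) \<le> 2 / 3"
proof -
  let ?L = "ln (real N)"
  have split: "{1..N} = insert N {1..<N}" using assms(1) by auto
  have "exp (s * of_real ?L) * zsum N s = 1 + (\<Sum>n=1..<N. exp (s * of_real (?L - ln (real n))))"
    unfolding zsum_def split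
    by (simp add: distrib_left sum_distrib_left right_diff_distrib flip: exp_add)
  then have "norm (exp (s * of_real ?L) * zsum N s - 1) =
      norm (\<Sum>n=1..<N. exp (s * of_real (?L - ln (real n))))" by simp
  also have "\<dots> \<le> (\<Sum>n=1..<N. (2 / 5) ^ (N - n))"
  proof (rule sum_norm_le)
    fix n assume n: "n \<in> {1..<N}"
    have "ln (real n) - ?L = ln (real n / real N)" using n by (simp add: ln_div)
    also have "\<dots> \<le> real n / real N - 1" using n by (intro ln_le_minus_one) auto
    finally have "real N * (ln (real n) - ?L) \<le> real N * (real n / real N - 1)"
      by (intro mult_left_mono) auto
    also have "\<dots> = - real (N - n)" using n by (simp add: field_simps of_nat_diff)
    finally have 1: "- real N * (?L - ln (real n)) \<le> - real (N - n)" by (simp add: algebra_simps)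
    have "norm (exp (s * of_real (?L - ln (real n)))) = exp (Re s * (?L - ln (real n)))"
      by simp
    also have "\<dots> \<le> exp (- real N * (?L - ln (real n)))"
      using assms(2) n by (subst exp_le_cancel_iff, intro mult_right_mono) auto
    also have "\<dots> \<le> exp (- real (N - n))" using 1 by (subst exp_le_cancel_iff)
    also have "\<dots> = exp (- 1) ^ (N - n)" by (simp flip: exp_of_nat_mult)
    also have "\<dots> \<le> (2 / 5) ^ (N - n)"
    proof (rule power_mono)
      have "5 / 2 \<le> exp (1 :: real)" using exp_lower_Taylor_quadratic[of 1] by simp
      then have "inverse (exp 1) \<le> inverse (5 / 2 :: real)" by (intro le_imp_inverse_le) auto
      then show "exp (- 1) \<le> (2 / 5 :: real)" by (simp add: exp_minus)
    qed simp
    finally show "norm (exp (s * of_real (?L - ln (real n)))) \<le> (2 / 5) ^ (N - n)" .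
  qed
  also have "\<dots> \<le> 2 / 3" by (rule sum_powers_two_fifths_le)
  finally show ?thesis .
qed

lemma zsum_nonzero_right: "N \<ge> 1 \<Longrightarrow> Re s \<ge> 3 \<Longrightarrow> zsum N s \<noteq> 0"
  using zsum_near_1[of N s] by auto

lemma zsum_nonzero_left: "N \<ge> 1 \<Longrightarrow> Re s \<le> - real N \<Longrightarrow> zsum N s \<noteq> 0"
  using scaled_zsum_near_1[of N s] by auto

lemma zsum_of_real_pos:
  assumes "N \<ge> 1" "Im s = 0"
  obtains r where "r > 0" "zsum N s = of_real r"
proof
  have "s = of_real (Re s)" using assms(2) by (simp add: complex_eq_iff)
  then show "zsum N s = of_real (\<Sum>n=1..N. exp (- (Re s * ln (real n))))"
    unfolding zsum_def by (metis (no_types, lifting) exp_of_real of_real_minus of_real_mult of_real_sum sum.cong)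
  show "(\<Sum>n=1..N. exp (- (Re s * ln (real n)))) > 0"
    using assms(1) by (intro sum_pos) auto
qed

text \<open>The value at 0 is \<open>N >= 2\<close>, while the value at 3 is within 2/3 of
  1.\<close>

lemma zsum_not_constant:
  assumes "N \<ge> 2"
  shows "\<not> zsum N constant_on UNIV"
proof
  assume "zsum N constant_on UNIV"
  then have "zsum N 3 = zsum N 0" by (auto simp: constant_on_def)
  moreover have "zsum N 0 = of_nat N" by (simp add: zsum_def)
  moreover have "norm (of_nat N - 1 :: complex) = real N - 1"
    using assms by (metis (no_types, lifting) norm_of_nat of_nat_1 of_nat_diff one_le_numeral order_trans)
  ultimately show False using zsum_near_1[of N 3] assms by simp
qed

section \<open>The integrals over the four edges\<close>

lemma Im_integral_bound:
  assumes "continuous_on {0..1} A" "\<And>t. t \<in> {0..1::real} \<Longrightarrow> \<bar>Im (A t)\<bar> \<le> B"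
  shows "\<bar>Im (integral {0..1} A)\<bar> \<le> B"
proof -
  have "((\<lambda>t. Im (A t)) has_integral Im (integral {0..1} A)) {0..1}"
    using assms(1) by (intro has_integral_Im integrable_integral integrable_continuous_real)
  then have "integral {0..1} (\<lambda>t. Im (A t)) = Im (integral {0..1} A)" by (rule integral_unique)
  then show ?thesis
    using integral_bound[of 0 1 "\<lambda>t. Im (A t)" B] assms by (auto intro: continuous_intros)
qed

lemma Re_integral_bound:
  assumes "continuous_on {0..1} A" "\<And>t. t \<in> {0..1::real} \<Longrightarrow> \<bar>Re (A t)\<bar> \<le> B"
  shows "\<bar>Re (integral {0..1} A)\<bar> \<le> B"
proof -
  have "((\<lambda>t. Re (A t)) has_integral Re (integral {0..1} A)) {0..1}"
    using assms(1) by (intro has_integral_Re integrable_integral integrable_continuous_real)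
  then have "integral {0..1} (\<lambda>t. Re (A t)) = Re (integral {0..1} A)" by (rule integral_unique)
  then show ?thesis
    using integral_bound[of 0 1 "\<lambda>t. Re (A t)" B] assms by (auto intro: continuous_intros)
qed

abbreviation weighted_log_deriv :: "nat \<Rightarrow> complex \<Rightarrow> complex \<Rightarrow> complex" where
  "weighted_log_deriv N w s \<equiv> (s - w) * (deriv (zsum N) s / zsum N s)"

lemma bottom_edge:
  assumes "N \<ge> 1" "U \<ge> real N" "T > 0"
  obtains I where "(weighted_log_deriv N (Complex (- U) T) has_contour_integral I)
      (linepath (Complex (- U) 0) (Complex 3 0))"
    "\<bar>Im I - T * U * ln (real N)\<bar> \<le> 12 * T"
proof -
  let ?a = "Complex (- U) 0" and ?b = "Complex 3 0" and ?w = "Complex (- U) T"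
  define A where "A t = Ln (zsum N (linepath ?a ?b t))" for t
  have pos: "\<exists>r>0. zsum N (linepath ?a ?b t) = of_real r" for t
    using zsum_of_real_pos[OF assms(1), of "linepath ?a ?b t"] by (auto simp: linepath_def)
  have A': "(A has_vector_derivative deriv (zsum N) (linepath ?a ?b t) / zsum N (linepath ?a ?b t)
      * (?b - ?a)) (at t within {0..1})" for t
    unfolding A_def[abs_def] using pos[of t]
    by (intro Ln_linepath_has_vector_derivative zsum_has_field_derivative) auto
  have Im_A: "Im (A t) = 0" for t
    using pos[of t] by (auto simp: A_def Ln_of_real)
  have contA: "continuous_on {0..1} A"
    using A' by (rule continuous_on_has_vector_derivative)
  have "\<bar>Im (integral {0..1} A)\<bar> \<le> 0"
    by (rule Im_integral_bound[OF contA]) (simp add: Im_A)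
  then have Im_int: "Im (integral {0..1} A) = 0" by simp
  have A1: "norm (A 1) \<le> 6"
    unfolding A_def using assms(1) by (intro norm_Ln_near_1 zsum_near_1) (auto simp: linepath_1')
  \<comment> \<open>This is the source of the main term: the value at \<open>-U\<close> is
    \<open>N^U\<close> times a positive number within 2/3 of 1.\<close>
  have A0: "\<bar>Re (A 0) - U * ln (real N)\<bar> \<le> 6"
  proof -
    obtain r where r: "r > 0" "zsum N ?a = of_real r" using pos[of 0] by (auto simp: linepath_0')
    have "exp (?a * of_real (ln (real N))) = of_real (exp (- U * ln (real N)))"
      by (simp add: Complex_eq flip: exp_of_real)
    then have "norm (Ln (of_real (exp (- U * ln (real N)) * r))) \<le> 6"
      using norm_Ln_near_1[OF scaled_zsum_near_1[of N ?a]] assms r by simp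
    then have "\<bar>ln (exp (- U * ln (real N)) * r)\<bar> \<le> 6"
      using r(1) by (subst (asm) Ln_of_real) (auto simp del: of_real_mult)
    then show ?thesis using r by (simp add: A_def linepath_0' Ln_of_real ln_mult)
  qed
  let ?I = "(?b - ?w) * A 1 - (?a - ?w) * A 0 - (?b - ?a) * integral {0..1} A"
  show ?thesis
  proof (rule that)
    show "(weighted_log_deriv N ?w has_contour_integral ?I) (linepath ?a ?b)"
      using A' by (rule has_contour_integral_linepath_by_parts)
    \<comment> \<open>\<open>A\<close> and \<open>?b - ?a\<close> are real, so only the imaginary
      part \<open>- T\<close> of the weight at the two endpoints contributes.\<close>
    have "Im ?I = T * Re (A 0) - T * Re (A 1)"
      by (simp add: Im_A Im_int)
    then have "Im ?I - T * U * ln (real N) = T * (Re (A 0) - U * ln (real N) - Re (A 1))"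
      by (simp add: algebra_simps)
    moreover have "\<bar>Re (A 0) - U * ln (real N) - Re (A 1)\<bar> \<le> 12"
      using A0 A1 abs_Re_le_cmod[of "A 1"] by linarith
    ultimately show "\<bar>Im ?I - T * U * ln (real N)\<bar> \<le> 12 * T"
      using assms(3) by (simp add: abs_mult mult.commute)
  qed
qed

lemma right_edge:
  assumes "N \<ge> 1" "U \<ge> 0" "T > 0"
  obtains I where "(weighted_log_deriv N (Complex (- U) T) has_contour_integral I)
      (linepath (Complex 3 0) (Complex 3 T))"
    "\<bar>Im I\<bar> \<le> 12 * (U + 3) + 12 * T"
proof -
  let ?a = "Complex 3 0" and ?b = "Complex 3 T" and ?w = "Complex (- U) T"
  define A where "A t = Ln (zsum N (linepath ?a ?b t))" for t
  have near: "norm (zsum N (linepath ?a ?b t) - 1) \<le> 2 / 3" for t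
    using assms(1) by (intro zsum_near_1) (auto simp: linepath_def algebra_simps)
  have A': "(A has_vector_derivative deriv (zsum N) (linepath ?a ?b t) / zsum N (linepath ?a ?b t)
      * (?b - ?a)) (at t within {0..1})" for t
    unfolding A_def[abs_def] using near
    by (intro Ln_linepath_has_vector_derivative zsum_has_field_derivative near_1_not_nonpos_Reals)
  have A6: "norm (A t) \<le> 6" for t
    unfolding A_def using near by (rule norm_Ln_near_1)
  have contA: "continuous_on {0..1} A"
    using A' by (rule continuous_on_has_vector_derivative)
  have int6: "norm (integral {0..1} A) \<le> 6"
    using integral_bound[OF _ contA, of 6] A6 by simp
  let ?I = "(?b - ?w) * A 1 - (?a - ?w) * A 0 - (?b - ?a) * integral {0..1} A"
  show ?thesis
  proof (rule that)
    show "(weighted_log_deriv N ?w has_contour_integral ?I) (linepath ?a ?b)"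
      using A' by (rule has_contour_integral_linepath_by_parts)
    have bw: "norm (?b - ?w) \<le> U + 3" and aw: "norm (?a - ?w) \<le> U + 3 + T" and ba: "norm (?b - ?a) \<le> T"
      using cmod_le[of "?b - ?w"] cmod_le[of "?a - ?w"] cmod_le[of "?b - ?a"] assms by simp_all
    have "norm ?I \<le> norm (?b - ?w) * norm (A 1) + norm (?a - ?w) * norm (A 0)
        + norm (?b - ?a) * norm (integral {0..1} A)"
      unfolding norm_mult[symmetric]
      by (intro order.trans[OF norm_triangle_ineq4] add_mono norm_triangle_ineq4 order_refl)
    also have "\<dots> \<le> (U + 3) * 6 + (U + 3 + T) * 6 + T * 6"
      using bw aw ba A6 int6 assms by (intro add_mono mult_mono) auto
    also have "\<dots> = 12 * (U + 3) + 12 * T" by (simp add: algebra_simps)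
    finally show "\<bar>Im ?I\<bar> \<le> 12 * (U + 3) + 12 * T"
      by (rule order.trans[OF abs_Im_le_cmod])
  qed
qed

lemma left_edge:
  assumes "N \<ge> 1" "U \<ge> real N" "T > 0"
  obtains I where "(weighted_log_deriv N (Complex (- U) T) has_contour_integral I)
      (linepath (Complex (- U) T) (Complex (- U) 0))"
    "\<bar>Im I\<bar> \<le> 12 * T"
proof -
  let ?w = "Complex (- U) T" and ?b = "Complex (- U) 0"
  let ?L = "complex_of_real (ln (real N))"
  let ?\<gamma> = "linepath ?w ?b"
  define G where "G s = exp (s * ?L) * zsum N s" for s
  \<comment> \<open>A logarithm of \<open>N^s F(s)\<close> minus \<open>s ln N\<close>, shifted by
    the constant \<open>U ln N\<close>. On the line Re s = -U the subtracted term is purely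
    imaginary, so \<open>Re A\<close> stays bounded by 6; \<open>?b - ?w\<close> is also purely
    imaginary, so \<open>Im ?I\<close> involves only \<open>Re A\<close>.\<close>
  define A where "A t = Ln (G (?\<gamma> t)) - ?L * (?\<gamma> t + of_real U)" for t
  have Re_\<gamma>: "Re (?\<gamma> t) = - U" for t by (simp add: linepath_def algebra_simps)
  have near: "norm (G (?\<gamma> t) - 1) \<le> 2 / 3" for t
    unfolding G_def using assms Re_\<gamma>[of t] by (intro scaled_zsum_near_1) auto
  have nz: "zsum N (?\<gamma> t) \<noteq> 0" for t
    using assms Re_\<gamma>[of t] by (intro zsum_nonzero_left) auto
  have A': "(A has_vector_derivative deriv (zsum N) (?\<gamma> t) / zsum N (?\<gamma> t) * (?b - ?w))
      (at t within {0..1})" for t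
  proof -
    let ?G' = "?L * exp (?\<gamma> t * ?L) * zsum N (?\<gamma> t) + exp (?\<gamma> t * ?L) * deriv (zsum N) (?\<gamma> t)"
    have "(G has_field_derivative ?G') (at (?\<gamma> t))"
      unfolding G_def[abs_def]
      by (rule derivative_eq_intros refl zsum_has_field_derivative)+ (simp add: algebra_simps)
    then have "((\<lambda>t. Ln (G (?\<gamma> t))) has_vector_derivative ?G' / G (?\<gamma> t) * (?b - ?w))
        (at t within {0..1})"
      using near by (intro Ln_linepath_has_vector_derivative near_1_not_nonpos_Reals)
    moreover have "((\<lambda>t. ?L * (?\<gamma> t + of_real U)) has_vector_derivative ?L * (?b - ?w)) (at t within {0..1})"
      by (rule derivative_eq_intros has_vector_derivative_linepath_within refl)+ simp
    ultimately have "(A has_vector_derivative ?G' / G (?\<gamma> t) * (?b - ?w) - ?L * (?b - ?w))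
        (at t within {0..1})"
      unfolding A_def[abs_def] by (rule has_vector_derivative_diff)
    moreover have "?G' / G (?\<gamma> t) = ?L + deriv (zsum N) (?\<gamma> t) / zsum N (?\<gamma> t)"
      using nz[of t] by (simp add: G_def field_simps)
    ultimately show ?thesis by (simp add: distrib_right)
  qed
  have contA: "continuous_on {0..1} A"
    using A' by (rule continuous_on_has_vector_derivative)
  have ReA: "\<bar>Re (A t)\<bar> \<le> 6" for t
    using abs_Re_le_cmod[of "Ln (G (?\<gamma> t))"] norm_Ln_near_1[OF near[of t]]
    by (simp add: A_def Re_\<gamma>)
  have Re_int: "\<bar>Re (integral {0..1} A)\<bar> \<le> 6"
    using contA ReA by (rule Re_integral_bound)
  let ?I = "(?b - ?w) * A 1 - (?w - ?w) * A 0 - (?b - ?w) * integral {0..1} A"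
  show ?thesis
  proof (rule that)
    show "(weighted_log_deriv N ?w has_contour_integral ?I) (linepath ?w ?b)"
      using A' by (rule has_contour_integral_linepath_by_parts)
    have "Im ?I = T * (Re (integral {0..1} A) - Re (A 1))"
      by (simp add: algebra_simps)
    moreover have "\<bar>Re (integral {0..1} A) - Re (A 1)\<bar> \<le> 12"
      using Re_int ReA[of 1] by linarith
    ultimately show "\<bar>Im ?I\<bar> \<le> 12 * T"
      using assms(3) by (simp add: abs_mult mult.commute)
  qed
qed

lemma top_edge:
  assumes "N \<ge> 1" "U \<ge> 0" and nz: "\<And>s. Im s = T \<Longrightarrow> zsum N s \<noteq> 0"
  obtains I where "(weighted_log_deriv N (Complex (- U) T) has_contour_integral I)
      (linepath (Complex 3 T) (Complex (- U) T))"
    "\<bar>Im I\<bar> \<le> (U + 3) * (pi * real N)"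
proof -
  let ?a = "Complex 3 T" and ?w = "Complex (- U) T"
  let ?\<gamma> = "linepath ?a ?w"
  have Im_\<gamma>: "Im (?\<gamma> t) = T" for t by (simp add: linepath_def algebra_simps)
  have Re_\<gamma>: "Re (?\<gamma> t) = 3 - (U + 3) * t" for t by (simp add: linepath_def algebra_simps)
  have nz': "zsum N z \<noteq> 0" if "z \<in> closed_segment ?a ?w" for z
    using that by (intro nz) (auto simp: closed_segment_same_Im)
  obtain A where A': "\<And>t. t \<in> {0..1} \<Longrightarrow> (A has_vector_derivative
        deriv (zsum N) (?\<gamma> t) / zsum N (?\<gamma> t) * (?w - ?a)) (at t within {0..1})"
    and exp_A: "\<And>t. t \<in> {0..1} \<Longrightarrow> exp (A t) = zsum N (?\<gamma> t)"
    using log_derivative_primitive_along_linepath[OF zsum_holomorphic nz'] by metis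
  have contA: "continuous_on {0..1} A"
    using A' by (rule continuous_on_has_vector_derivative)
  have var: "\<bar>Im (A t - A 0)\<bar> \<le> pi * real N" if t: "t \<in> {0..1}" for t
  proof -
    \<comment> \<open>Because \<open>exp A = F\<close>, a zero of \<open>cos (Im A)\<close> is a
      zero of \<open>Re F\<close>, which is an exponential sum in the abscissa with \<open>N\<close>
      terms. The coefficient for n = 1 is \<open>cos 0 = 1\<close>, so there are at most
      \<open>N - 1\<close> such zeros.\<close>
    have "\<bar>Im (A t) - Im (A 0)\<bar> \<le> pi * (real (N - 1) + 1)"
    proof (rule variation_le_of_cos_zeros[where \<theta> = "\<lambda>t. Im (A t)"])
      show "continuous_on {0..t} (\<lambda>t. Im (A t))"
        by (intro continuous_intros continuous_on_subset[OF contA]) (use t in auto)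
      fix Z assume Z: "finite Z" "Z \<subseteq> {0..t}" "\<And>x. x \<in> Z \<Longrightarrow> cos (Im (A x)) = 0"
      let ?g = "\<lambda>x. 3 - (U + 3) * x"
      have "card (?g ` Z) < card {1..N}"
      proof (rule card_zeros_exponential_sum[where l = "\<lambda>n. - ln (real n)" and c = "\<lambda>n. cos (T * ln (real n))"])
        show "inj_on (\<lambda>n. - ln (real n)) {1..N}" by (auto simp: inj_on_def)
        show "\<exists>i\<in>{1..N}. cos (T * ln (real i)) \<noteq> 0"
          using assms(1) by (intro bexI[of _ 1]) auto
        fix y assume "y \<in> ?g ` Z"
        then obtain x where x: "x \<in> Z" "y = ?g x" by auto
        have "x \<in> {0..1}" using x Z(2) t by auto
        have "Re (zsum N (?\<gamma> x)) = 0"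
          using Z(3)[OF x(1)] by (simp add: Re_exp flip: exp_A[OF \<open>x \<in> {0..1}\<close>])
        moreover have "Re (zsum N (?\<gamma> x)) = (\<Sum>n = 1..N. cos (T * ln (real n)) * exp (- ln (real n) * y))"
          by (simp add: zsum_def Re_exp Im_\<gamma> Re_\<gamma> x(2) mult.commute)
        ultimately show "(\<Sum>n = 1..N. cos (T * ln (real n)) * exp (- ln (real n) * y)) = 0" by simp
      qed (use Z in auto)
      moreover have "inj_on ?g Z" using assms(2) by (auto simp: inj_on_def)
      ultimately show "card Z \<le> N - 1" by (simp add: card_image)
    qed (use t in auto)
    then show ?thesis using assms(1) by (simp add: of_nat_diff)
  qed
  let ?I = "(?w - ?w) * A 1 - (?a - ?w) * A 0 - (?w - ?a) * integral {0..1} A"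
  show ?thesis
  proof (rule that)
    show "(weighted_log_deriv N ?w has_contour_integral ?I) (linepath ?a ?w)"
      using A' by (rule has_contour_integral_linepath_by_parts)
    \<comment> \<open>The weight vanishes at \<open>?w\<close>, and its value \<open>U + 3\<close>
      at \<open>?a\<close> is also the length of the edge. The boundary term therefore combines with
      the integral, leaving only the variation of \<open>A\<close> from its initial value.\<close>
    have int: "integral {0..1} (\<lambda>t. A t - A 0) = integral {0..1} A - A 0"
      using contA by (subst Henstock_Kurzweil_Integration.integral_diff)
        (auto intro!: integrable_continuous_real)
    have "\<bar>Im (integral {0..1} (\<lambda>t. A t - A 0))\<bar> \<le> pi * real N"
      using contA var by (intro Im_integral_bound continuous_intros) auto
    moreover have "Im ?I = (U + 3) * Im (integral {0..1} (\<lambda>t. A t - A 0))"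
      by (simp add: int algebra_simps)
    ultimately show "\<bar>Im ?I\<bar> \<le> (U + 3) * (pi * real N)"
      using assms(2) by (simp add: abs_mult mult_left_mono)
  qed
qed

section \<open>The argument principle and the final estimate\<close>

lemma zero_sum_eq_contour_integral:
  assumes "N \<ge> 2" "U \<ge> real N" "T > 0" and nz: "\<And>s. Im s = T \<Longrightarrow> zsum N s \<noteq> 0"
  shows "contour_integral (rectpath (Complex (- U) 0) (Complex 3 T)) (weighted_log_deriv N w) =
    2 * pi * \<i> * (\<Sum>\<rho> | zsum N \<rho> = 0 \<and> 0 < Im \<rho> \<and> Im \<rho> \<le> T.
      (\<rho> - w) * of_int (zorder (zsum N) \<rho>))"
proof -
  let ?g = "rectpath (Complex (- U) 0) (Complex 3 T)"
  let ?R = "{\<rho>. zsum N \<rho> = 0 \<and> 0 < Im \<rho> \<and> Im \<rho> \<le> T}"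
  \<comment> \<open>An open box around the closed rectangle, as the argument principle requires. In
    \<open>pz\<close> the empty set stands for the poles.\<close>
  define S where "S = box (Complex (- U - 1) (- 1)) (Complex 4 (T + 1))"
  define pz where "pz = {z \<in> S. zsum N z = 0 \<or> z \<in> {}}"
  have N1: "N \<ge> 1" and U: "U \<ge> 0" using assms by auto
  have nz_real: "zsum N z \<noteq> 0" if "Im z = 0" for z
    using zsum_of_real_pos[OF N1 that] by force
  have nz_left: "zsum N z \<noteq> 0" if "Re z \<le> - U" for z
    using that assms(2) by (intro zsum_nonzero_left[OF N1]) auto
  have nz_right: "zsum N z \<noteq> 0" if "Re z \<ge> 3" for z
    using that by (intro zsum_nonzero_right[OF N1])
  have "finite {z \<in> cbox (Complex (- U - 1) (- 1)) (Complex 4 (T + 1)). zsum N z = 0}"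
    using zsum_not_constant[OF assms(1)]
    by (intro holomorphic_compact_finite_zeros[of _ UNIV] zsum_holomorphic) auto
  then have fin: "finite pz"
    by (rule finite_subset[rotated]) (auto simp: pz_def S_def box_subset_cbox[THEN subsetD])
  have R_sub: "?R \<subseteq> pz"
    using nz_left nz_right U by (force simp: pz_def S_def in_box_complex_iff)
  have wind1: "winding_number ?g \<rho> = 1" if "\<rho> \<in> ?R" for \<rho>
  proof (rule winding_number_rectpath)
    have "Re \<rho> > - U" "Re \<rho> < 3" "Im \<rho> \<noteq> T"
      using nz_left[of \<rho>] nz_right[of \<rho>] nz[of \<rho>] that by (force simp: not_le)+
    then show "\<rho> \<in> box (Complex (- U) 0) (Complex 3 T)"
      using that by (auto simp: in_box_complex_iff)
  qed
  \<comment> \<open>\<open>F\<close> has no real zeros, so the zeros in \<open>S\<close> outside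
    \<open>?R\<close> lie below the real axis or above height \<open>T\<close>.\<close>
  have wind0: "winding_number ?g \<rho> = 0" if "\<rho> \<in> pz - ?R" for \<rho>
  proof (rule winding_number_rectpath_outside)
    have "Im \<rho> \<noteq> 0" using nz_real[of \<rho>] that by (auto simp: pz_def)
    then show "\<rho> \<notin> cbox (Complex (- U) 0) (Complex 3 T)"
      using that by (auto simp: in_cbox_complex_iff pz_def)
  qed (use U assms in auto)
  have "contour_integral ?g (\<lambda>s. deriv (zsum N) s * (s - w) / zsum N s) =
      2 * pi * \<i> * (\<Sum>p\<in>pz. winding_number ?g p * (p - w) * zorder (zsum N) p)"
    unfolding pz_def
  proof (rule argument_principle)
    show "open S" "connected S" by (auto simp: S_def intro: convex_connected convex_box)
    show "path_image ?g \<subseteq> S - {z \<in> S. zsum N z = 0 \<or> z \<in> {}}"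
    proof
      fix z assume "z \<in> path_image ?g"
      then have z: "(Re z = - U \<or> Re z = 3) \<and> 0 \<le> Im z \<and> Im z \<le> T \<or>
          (Im z = 0 \<or> Im z = T) \<and> - U \<le> Re z \<and> Re z \<le> 3"
        using U assms(3) by (subst (asm) path_image_rectpath) auto
      then have "z \<in> S" using U assms(3) by (auto simp: S_def in_box_complex_iff)
      moreover have "zsum N z \<noteq> 0"
        using z nz_left[of z] nz_right[of z] nz_real[of z] nz[of z] by auto
      ultimately show "z \<in> S - {z \<in> S. zsum N z = 0 \<or> z \<in> {}}" by simp
    qed
    show "\<forall>z. z \<notin> S \<longrightarrow> winding_number ?g z = 0"
    proof (intro allI impI winding_number_rectpath_outside)
      fix z assume "z \<notin> S"
      then show "z \<notin> cbox (Complex (- U) 0) (Complex 3 T)"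
        by (auto simp: S_def in_box_complex_iff in_cbox_complex_iff)
    qed (use U assms in auto)
    show "finite {z \<in> S. zsum N z = 0 \<or> z \<in> {}}" using fin by (simp add: pz_def)
  qed (auto intro: zsum_holomorphic holomorphic_intros)
  also have "(\<Sum>p\<in>pz. winding_number ?g p * (p - w) * zorder (zsum N) p) =
      (\<Sum>p\<in>?R. (p - w) * zorder (zsum N) p)"
    using wind0 wind1 by (intro sum.mono_neutral_cong_right fin R_sub) auto
  also have "(\<lambda>s. deriv (zsum N) s * (s - w) / zsum N s) = weighted_log_deriv N w"
    by (simp add: fun_eq_iff mult.commute)
  finally show ?thesis .
qed

text \<open>Taking imaginary parts of \<open>2 pi i\<close> times the weighted zero sum selects
  \<open>Re (\<rho> - w) = Re \<rho> + U\<close>. The bottom, right and left edges each cost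
  \<open>12 * T\<close>; the right edge also gives \<open>12 * (U + 3)\<close> and the top edge
  \<open>pi * N * (U + 3)\<close>.\<close>

lemma zero_sum_estimate:
  assumes "N \<ge> 2" "U \<ge> real N" "T > 0" and nz: "\<And>s. Im s = T \<Longrightarrow> zsum N s \<noteq> 0"
  shows "\<bar>2 * pi * (\<Sum>\<rho> | zsum N \<rho> = 0 \<and> 0 < Im \<rho> \<and> Im \<rho> \<le> T.
        of_int (zorder (zsum N) \<rho>) * (Re \<rho> + U)) - T * U * ln (real N)\<bar>
      \<le> 36 * T + (U + 3) * (12 + pi * real N)"
proof -
  let ?w = "Complex (- U) T"
  let ?g = "rectpath (Complex (- U) 0) (Complex 3 T)"
  have N1: "N \<ge> 1" and U: "U \<ge> 0" using assms by auto
  obtain I1 where I1: "(weighted_log_deriv N ?w has_contour_integral I1)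
      (linepath (Complex (- U) 0) (Complex 3 0))" "\<bar>Im I1 - T * U * ln (real N)\<bar> \<le> 12 * T"
    using bottom_edge[OF N1 assms(2,3)] .
  obtain I2 where I2: "(weighted_log_deriv N ?w has_contour_integral I2)
      (linepath (Complex 3 0) (Complex 3 T))" "\<bar>Im I2\<bar> \<le> 12 * (U + 3) + 12 * T"
    using right_edge[OF N1 U assms(3)] .
  obtain I3 where I3: "(weighted_log_deriv N ?w has_contour_integral I3)
      (linepath (Complex 3 T) ?w)" "\<bar>Im I3\<bar> \<le> (U + 3) * (pi * real N)"
    using top_edge[OF N1 U nz] .
  obtain I4 where I4: "(weighted_log_deriv N ?w has_contour_integral I4)
      (linepath ?w (Complex (- U) 0))" "\<bar>Im I4\<bar> \<le> 12 * T"
    using left_edge[OF N1 assms(2,3)] .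
  have "(weighted_log_deriv N ?w has_contour_integral (I1 + (I2 + (I3 + I4)))) ?g"
    unfolding rectpath_def Let_def
    using I1(1) I2(1) I3(1) I4(1) by (intro has_contour_integral_join) auto
  then have "I1 + (I2 + (I3 + I4)) = contour_integral ?g (weighted_log_deriv N ?w)"
    by (rule contour_integral_unique[symmetric])
  also have "\<dots> = 2 * pi * \<i> * (\<Sum>\<rho> | zsum N \<rho> = 0 \<and> 0 < Im \<rho> \<and> Im \<rho> \<le> T.
      (\<rho> - ?w) * of_int (zorder (zsum N) \<rho>))"
    by (rule zero_sum_eq_contour_integral[OF assms])
  finally have "Im (I1 + (I2 + (I3 + I4))) = Im (2 * pi * \<i> *
      (\<Sum>\<rho> | zsum N \<rho> = 0 \<and> 0 < Im \<rho> \<and> Im \<rho> \<le> T. (\<rho> - ?w) * of_int (zorder (zsum N) \<rho>)))"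
    by simp
  also have "\<dots> = 2 * pi * (\<Sum>\<rho> | zsum N \<rho> = 0 \<and> 0 < Im \<rho> \<and> Im \<rho> \<le> T.
        of_int (zorder (zsum N) \<rho>) * (Re \<rho> + U))"
    by (simp add: mult.commute)
  finally have eq: "2 * pi * (\<Sum>\<rho> | zsum N \<rho> = 0 \<and> 0 < Im \<rho> \<and> Im \<rho> \<le> T.
      of_int (zorder (zsum N) \<rho>) * (Re \<rho> + U)) = Im I1 + Im I2 + Im I3 + Im I4"
    by simp
  have "\<bar>Im I1 + Im I2 + Im I3 + Im I4 - T * U * ln (real N)\<bar>
      \<le> 12 * T + (12 * (U + 3) + 12 * T) + (U + 3) * (pi * real N) + 12 * T"
    using I1(2) I2(2) I3(2) I4(2) by linarith
  also have "\<dots> = 36 * T + (U + 3) * (12 + pi * real N)" by (simp add: algebra_simps)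
  finally show ?thesis unfolding eq .
qed

text \<open>The main term carries the logarithm of the integer part of \<open>X\<close>, on which
  alone \<open>F\<close> depends. Replacing it by \<open>ln X\<close> would change the main term by
  \<open>U * T / (2 * pi) * ln (X / N)\<close> with N that integer part; for fixed nonintegral
  \<open>X\<close> and \<open>U = T\<close> this grows like \<open>T^2\<close>, beyond the error
  terms.\<close>

theorem theorem8:
  shows "\<exists>C\<^sub>1 C\<^sub>2 :: real. \<forall>X T U :: real. 2 \<le> X \<longrightarrow> X \<le> T \<longrightarrow> X \<le> U \<longrightarrow>
    \<bar>(\<Sum>\<rho>\<in>zeta_partial_sum_zeros X T.
         real_of_int (zorder (zeta_partial_sum X) \<rho>) * (Re \<rho> + U))
       - U * (T / (2 * pi)) * ln (real_of_int \<lfloor>X\<rfloor>)\<bar>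
     \<le> C\<^sub>1 * (U * X) + C\<^sub>2 * T"
proof (intro exI allI impI)
  fix X T U :: real
  assume X: "2 \<le> X" and T: "X \<le> T" and U: "X \<le> U"
  define N where "N = nat \<lfloor>X\<rfloor>"
  have N: "N \<ge> 2" "real N \<le> X" "real_of_int \<lfloor>X\<rfloor> = real N"
    using X by (auto simp: N_def le_nat_floor le_floor_iff)
  have F: "zeta_partial_sum X = zsum N"
    by (simp add: zeta_partial_sum_eq_zsum N_def)
  define B where "B = U * ln (real N)"
  have B: "B \<ge> 0" using N U X by (simp add: B_def)
  define W where "W = (\<Sum>\<rho>\<in>zeta_partial_sum_zeros X T. real_of_int (zorder (zeta_partial_sum X) \<rho>) * (Re \<rho> + U))"
  \<comment> \<open>Zeros may lie on the line \<open>Im s = T\<close>; integrate along a slightly higher zero-free line.\<close>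
  have "\<forall>\<^sub>F T' in at_right T. \<forall>\<rho>\<in>zeta_partial_sum_zeros X (2 * T). \<not> (T < Im \<rho> \<and> Im \<rho> \<le> T')"
  proof (intro eventually_ball_finite ballI)
    show "finite (zeta_partial_sum_zeros X (2 * T))"
      using X by (intro finite_zeta_partial_sum_zeros) auto
    fix \<rho>
    show "\<forall>\<^sub>F T' in at_right T. \<not> (T < Im \<rho> \<and> Im \<rho> \<le> T')"
    proof (cases "T < Im \<rho>")
      case True
      show ?thesis using eventually_at_right_real[OF True] by eventually_elim auto
    qed simp
  qed
  moreover have "\<forall>\<^sub>F T' in at_right T. T' \<in> {T<..<2 * T}"
    using X T by (intro eventually_at_right_real) auto
  \<comment> \<open>Raising the height by less than \<open>1 / (B + 1)\<close> changes the main term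
    \<open>T * B\<close> by at most 1.\<close>
  moreover have "\<forall>\<^sub>F T' in at_right T. T' \<in> {T<..<T + 1 / (B + 1)}"
    using B by (intro eventually_at_right_real) auto
  ultimately have "\<forall>\<^sub>F T' in at_right T. T < T' \<and> T' < 2 * T \<and> T' < T + 1 / (B + 1) \<and>
      (\<forall>\<rho>\<in>zeta_partial_sum_zeros X (2 * T). \<not> (T < Im \<rho> \<and> Im \<rho> \<le> T'))"
    by eventually_elim auto
  then obtain T' where T': "T < T'" "T' < 2 * T" "T' < T + 1 / (B + 1)"
    and no: "\<And>\<rho>. \<rho> \<in> zeta_partial_sum_zeros X (2 * T) \<Longrightarrow> \<not> (T < Im \<rho> \<and> Im \<rho> \<le> T')"
    using eventually_happens'[OF trivial_limit_at_right_real] by blast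
  have T0: "T > 0" using X T by linarith
  have nz: "zsum N s \<noteq> 0" if "Im s = T'" for s
    using no[of s] that T' T0 by (auto simp: zeta_partial_sum_zeros_def F)
  have "{\<rho>. zsum N \<rho> = 0 \<and> 0 < Im \<rho> \<and> Im \<rho> \<le> T'} = zeta_partial_sum_zeros X T"
    using no T' T0 by (fastforce simp: zeta_partial_sum_zeros_def F)
  then have est: "\<bar>2 * pi * W - T' * B\<bar> \<le> 36 * T' + (U + 3) * (12 + pi * real N)"
    using zero_sum_estimate[of N U T'] N U T' T0 nz by (simp add: W_def F B_def mult.assoc)
  have "(T' - T) * (B + 1) \<le> 1" using T' B by (simp add: field_simps)
  moreover have "(T' - T) * B \<le> (T' - T) * (B + 1)" "0 \<le> (T' - T) * B"
    using T' B by (auto intro: mult_left_mono)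
  ultimately have "\<bar>T' * B - T * B\<bar> \<le> 1" by (simp add: algebra_simps abs_le_iff)
  then have 1: "\<bar>2 * pi * W - T * B\<bar> \<le> 72 * T + (U + 3) * (12 + pi * real N) + 1"
    using est T' by linarith
  \<comment> \<open>From U >= 2 and X >= 2: \<open>U + 3 <= 3 * U\<close>,
    \<open>12 <= 6 * X\<close> and \<open>pi * N <= 4 * X\<close>. This gives
    \<open>30 * (U * X)\<close>, and the height shift of at most 1 adds one more
    \<open>U * X\<close>.\<close>
  have "(U + 3) * (12 + pi * real N) \<le> (3 * U) * (6 * X + 4 * X)"
    using U X N pi_less_4 by (intro mult_mono add_mono) auto
  moreover have "1 * 1 \<le> U * X" using U X by (intro mult_mono) auto
  ultimately have 2: "\<bar>2 * pi * W - T * B\<bar> \<le> 31 * (U * X) + 72 * T"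
    using 1 by (simp add: algebra_simps)
  have "W - U * (T / (2 * pi)) * ln (real N) = (2 * pi * W - T * B) / (2 * pi)"
    by (simp add: B_def field_simps)
  then have "\<bar>W - U * (T / (2 * pi)) * ln (real N)\<bar> = \<bar>2 * pi * W - T * B\<bar> / (2 * pi)"
    by (simp add: abs_divide)
  also have "\<dots> \<le> \<bar>2 * pi * W - T * B\<bar> / 1"
    using pi_gt3 by (intro divide_left_mono) auto
  finally show "\<bar>(\<Sum>\<rho>\<in>zeta_partial_sum_zeros X T.
         real_of_int (zorder (zeta_partial_sum X) \<rho>) * (Re \<rho> + U))
       - U * (T / (2 * pi)) * ln (real_of_int \<lfloor>X\<rfloor>)\<bar> \<le> 31 * (U * X) + 72 * T"
    using 2 by (simp add: W_def N(3))
qed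

end
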